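(* Let $\mathbb{K}$ be a Lefschetz complex and let $f\colon\mathbb{K}\to\mathbb{R}$ be a discrete Morse-Bott function. Every weakly critical set of $f$ is a subcomplex of $\mathbb{K}$.
   Context: A Lefschetz complex is a triple $\mathbb{K}=(X,\dim,w)$, where $X$ is a set (of cells), $\dim\colon X\to\mathbb{Z}_{\ge0}$ and $w\colon X\times X\to\mathbb{R}$ are functions, $\dim^{-1}(k)$ is finite for every $k$, and: (L1) $w(\tau,\sigma)\neq0$ implies $\dim\tau-\dim\sigma=1$; (L2) $\sum_{\sigma\in X}w(\tau,\sigma)w(\sigma,\nu)=0$ for all $\tau,\nu\in X$. A subset $A\subset X$ is a subcomplex of $\mathbb{K}$ if $(A,\dim|_A,w|_{A\times A})$ is a Lefschetz complex. For $f\colon\mathbb{K}\to\mathbb{R}$ and $\sigma\in\mathbb{K}$ put $U^{\mathrm{snc}}(\sigma)=\#\{\tau\in X\mid w(\tau,\sigma)\ne0,\ f(\sigma)>f(\tau)\}$ and $D^{\mathrm{snc}}(\sigma)=\#\{\nu\in X\mid w(\sigma,\nu)\ne0,\ f(\sigma)<f(\nu)\}$. $f$ is a discrete Morse-Bott function if $U^{\mathrm{snc}}(\sigma)\le1$ and $D^{\mathrm{snc}}(\sigma)\le1$ for every cell $\sigma$. A level set of $f$ is a nonempty set of the form $L=\{\sigma\in X\mid f(\sigma)=r\}$ with $r\in\mathbb{R}$; for a level set $L$, the set $\{\sigma\in L\mid U^{\mathrm{snc}}(\sigma)+D^{\mathrm{snc}}(\sigma)=0\}$ is called a weakly critical set.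 *)

theory Defs
  imports Complex_Main
begin

text \<open>
  The carrier \<open>X\<close> may be infinite, so \<open>\<Sum>\<sigma>\<in>X. \<dots>\<close> would silently be 0. The sum in (L2)
  therefore runs over its support, which the other axioms force to be finite; see
  \<open>finite_support\<close> below.
\<close>

locale lefschetz_complex =
  fixes X :: "'a set" and cdim :: "'a \<Rightarrow> nat" and w :: "'a \<Rightarrow> 'a \<Rightarrow> real"
  assumes finite_dim: "finite {\<sigma> \<in> X. cdim \<sigma> = k}"
    and L1: "\<lbrakk>\<tau> \<in> X; \<sigma> \<in> X; w \<tau> \<sigma> \<noteq> 0\<rbrakk> \<Longrightarrow> int (cdim \<tau>) - int (cdim \<sigma>) = 1"
    and L2: "\<lbrakk>\<tau> \<in> X; \<nu> \<in> X\<rbrakk> \<Longrightarrow>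
      (\<Sum>\<sigma> | \<sigma> \<in> X \<and> w \<tau> \<sigma> * w \<sigma> \<nu> \<noteq> 0. w \<tau> \<sigma> * w \<sigma> \<nu>) = 0"
begin

lemma finite_faces:
  assumes "\<sigma> \<in> X"
  shows "finite {\<nu> \<in> X. w \<sigma> \<nu> \<noteq> 0}"
proof (rule finite_subset[OF _ finite_dim[of "cdim \<sigma> - 1"]])
  show "{\<nu> \<in> X. w \<sigma> \<nu> \<noteq> 0} \<subseteq> {\<nu> \<in> X. cdim \<nu> = cdim \<sigma> - 1}"
    using L1[OF assms] by fastforce
qed

lemma finite_cofaces:
  assumes "\<sigma> \<in> X"
  shows "finite {\<tau> \<in> X. w \<tau> \<sigma> \<noteq> 0}"
proof (rule finite_subset[OF _ finite_dim[of "cdim \<sigma> + 1"]])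
  show "{\<tau> \<in> X. w \<tau> \<sigma> \<noteq> 0} \<subseteq> {\<tau> \<in> X. cdim \<tau> = cdim \<sigma> + 1}"
    using L1[OF _ assms] by fastforce
qed

lemma finite_support:
  assumes "\<tau> \<in> X"
  shows "finite {\<sigma> \<in> X. w \<tau> \<sigma> * w \<sigma> \<nu> \<noteq> 0}"
  by (rule finite_subset[OF _ finite_faces[OF assms]]) auto

end

text \<open>
  \<open>lefschetz_complex A cdim w\<close> depends only on the values of \<open>cdim\<close> and \<open>w\<close> on \<open>A\<close> and
  \<open>A \<times> A\<close>, so the restrictions to \<open>A\<close> are left implicit.
\<close>

definition is_subcomplex :: "'a set \<Rightarrow> ('a \<Rightarrow> nat) \<Rightarrow> ('a \<Rightarrow> 'a \<Rightarrow> real) \<Rightarrow> 'a set \<Rightarrow> bool" where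
  "is_subcomplex X cdim w A \<longleftrightarrow> A \<subseteq> X \<and> lefschetz_complex A cdim w"

text \<open>
  By \<open>finite_cofaces\<close> and \<open>finite_faces\<close>, the sets counted here are finite for every cell
  of a Lefschetz complex.
\<close>

definition U_snc :: "'a set \<Rightarrow> ('a \<Rightarrow> 'a \<Rightarrow> real) \<Rightarrow> ('a \<Rightarrow> real) \<Rightarrow> 'a \<Rightarrow> nat" where
  "U_snc X w f \<sigma> = card {\<tau> \<in> X. w \<tau> \<sigma> \<noteq> 0 \<and> f \<sigma> > f \<tau>}"

definition D_snc :: "'a set \<Rightarrow> ('a \<Rightarrow> 'a \<Rightarrow> real) \<Rightarrow> ('a \<Rightarrow> real) \<Rightarrow> 'a \<Rightarrow> nat" where
  "D_snc X w f \<sigma> = card {\<nu> \<in> X. w \<sigma> \<nu> \<noteq> 0 \<and> f \<sigma> < f \<nu>}"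

definition discrete_morse_bott :: "'a set \<Rightarrow> ('a \<Rightarrow> 'a \<Rightarrow> real) \<Rightarrow> ('a \<Rightarrow> real) \<Rightarrow> bool" where
  "discrete_morse_bott X w f \<longleftrightarrow> (\<forall>\<sigma>\<in>X. U_snc X w f \<sigma> \<le> 1 \<and> D_snc X w f \<sigma> \<le> 1)"

definition level_set :: "'a set \<Rightarrow> ('a \<Rightarrow> real) \<Rightarrow> 'a set \<Rightarrow> bool" where
  "level_set X f L \<longleftrightarrow> L \<noteq> {} \<and> (\<exists>r. L = {\<sigma> \<in> X. f \<sigma> = r})"

definition weakly_critical_set ::
  "'a set \<Rightarrow> ('a \<Rightarrow> 'a \<Rightarrow> real) \<Rightarrow> ('a \<Rightarrow> real) \<Rightarrow> 'a set \<Rightarrow> bool" where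
  "weakly_critical_set X w f C \<longleftrightarrow>
    (\<exists>L. level_set X f L \<and> C = {\<sigma> \<in> L. U_snc X w f \<sigma> + D_snc X w f \<sigma> = 0})"

end

theory Submission
  imports Defs
begin

text \<open>
  Fix weakly critical cells \<open>\<tau>\<close> and \<open>\<nu>\<close> of value \<open>r\<close>, and let \<open>\<sigma>\<close> lie between them, that is,
  \<open>w \<tau> \<sigma>\<close> and \<open>w \<sigma> \<nu>\<close> are nonzero. The claim is that \<open>\<sigma>\<close> is weakly critical of value \<open>r\<close> too.
  Then the sum in (L2) for \<open>\<tau>\<close> and \<open>\<nu>\<close> has the same nonzero terms over the weakly critical
  set as over the whole complex; the other axioms pass to subsets at once.

  Since \<open>\<tau>\<close> has no face of larger value and \<open>\<nu>\<close> no coface of smaller value, \<open>f \<sigma> = r\<close>.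
  Suppose \<open>\<sigma>\<close> had a coface \<open>\<tau>'\<close> with \<open>f \<tau>' < r\<close>. A vanishing sum cannot have exactly one
  nonzero term, so by (L2) there is a second cell \<open>\<sigma>'\<close> between \<open>\<tau>'\<close> and \<open>\<nu>\<close>. As a coface of
  \<open>\<nu>\<close>, it has value at least \<open>r\<close>. So \<open>\<sigma>\<close> and \<open>\<sigma>'\<close> are two faces of \<open>\<tau>'\<close> of larger value
  than \<open>\<tau>'\<close>, against the Morse-Bott condition at \<open>\<tau>'\<close>. A face of \<open>\<sigma>\<close> of value above \<open>r\<close> is
  excluded in the dual way, using \<open>\<tau>\<close> instead of \<open>\<nu>\<close>.
\<close>

context lefschetz_complex
begin

text \<open>The analogue of the diamond property of simplicial complexes: otherwise the sum in (L2)
  would consist of a single nonzero term.\<close>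

lemma ex_other_cell_between:
  assumes "\<tau> \<in> X" "\<sigma> \<in> X" "\<nu> \<in> X" and "w \<tau> \<sigma> \<noteq> 0" "w \<sigma> \<nu> \<noteq> 0"
  obtains \<sigma>' where "\<sigma>' \<in> X" "\<sigma>' \<noteq> \<sigma>" "w \<tau> \<sigma>' \<noteq> 0" "w \<sigma>' \<nu> \<noteq> 0"
proof -
  have "{\<sigma>' \<in> X. w \<tau> \<sigma>' * w \<sigma>' \<nu> \<noteq> 0} \<noteq> {\<sigma>}"
  proof
    assume "{\<sigma>' \<in> X. w \<tau> \<sigma>' * w \<sigma>' \<nu> \<noteq> 0} = {\<sigma>}"
    then show False
      using L2[OF \<open>\<tau> \<in> X\<close> \<open>\<nu> \<in> X\<close>] assms(4,5) by simp
  qed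
  moreover have "\<sigma> \<in> {\<sigma>' \<in> X. w \<tau> \<sigma>' * w \<sigma>' \<nu> \<noteq> 0}"
    using assms by simp
  ultimately obtain \<sigma>' where "\<sigma>' \<in> {\<sigma>' \<in> X. w \<tau> \<sigma>' * w \<sigma>' \<nu> \<noteq> 0}" "\<sigma>' \<noteq> \<sigma>"
    by blast
  then show thesis
    using that[of \<sigma>'] by simp
qed

lemma U_snc_eq_0_iff:
  assumes "\<sigma> \<in> X"
  shows "U_snc X w f \<sigma> = 0 \<longleftrightarrow> (\<forall>\<tau>\<in>X. w \<tau> \<sigma> \<noteq> 0 \<longrightarrow> f \<sigma> \<le> f \<tau>)"
proof -
  have "finite {\<tau> \<in> X. w \<tau> \<sigma> \<noteq> 0 \<and> f \<sigma> > f \<tau>}"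
    by (rule finite_subset[OF _ finite_cofaces[OF assms]]) auto
  then show ?thesis
    by (auto simp: U_snc_def not_less)
qed

lemma D_snc_eq_0_iff:
  assumes "\<sigma> \<in> X"
  shows "D_snc X w f \<sigma> = 0 \<longleftrightarrow> (\<forall>\<nu>\<in>X. w \<sigma> \<nu> \<noteq> 0 \<longrightarrow> f \<nu> \<le> f \<sigma>)"
proof -
  have "finite {\<nu> \<in> X. w \<sigma> \<nu> \<noteq> 0 \<and> f \<sigma> < f \<nu>}"
    by (rule finite_subset[OF _ finite_faces[OF assms]]) auto
  then show ?thesis
    by (auto simp: D_snc_def not_less)
qed

lemma lower_coface_unique:
  assumes "discrete_morse_bott X w f" and "\<sigma> \<in> X"
    and "\<tau> \<in> X" "w \<tau> \<sigma> \<noteq> 0" "f \<tau> < f \<sigma>"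
    and "\<tau>' \<in> X" "w \<tau>' \<sigma> \<noteq> 0" "f \<tau>' < f \<sigma>"
  shows "\<tau> = \<tau>'"
proof -
  have "finite {\<tau> \<in> X. w \<tau> \<sigma> \<noteq> 0 \<and> f \<sigma> > f \<tau>}"
    by (rule finite_subset[OF _ finite_cofaces[OF \<open>\<sigma> \<in> X\<close>]]) auto
  moreover have "card {\<tau> \<in> X. w \<tau> \<sigma> \<noteq> 0 \<and> f \<sigma> > f \<tau>} \<le> Suc 0"
    using assms(1,2) by (simp add: discrete_morse_bott_def U_snc_def)
  ultimately show ?thesis
    using assms(3-) by (simp add: card_le_Suc0_iff_eq)
qed

lemma higher_face_unique:
  assumes "discrete_morse_bott X w f" and "\<sigma> \<in> X"
    and "\<nu> \<in> X" "w \<sigma> \<nu> \<noteq> 0" "f \<sigma> < f \<nu>"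
    and "\<nu>' \<in> X" "w \<sigma> \<nu>' \<noteq> 0" "f \<sigma> < f \<nu>'"
  shows "\<nu> = \<nu>'"
proof -
  have "finite {\<nu> \<in> X. w \<sigma> \<nu> \<noteq> 0 \<and> f \<sigma> < f \<nu>}"
    by (rule finite_subset[OF _ finite_faces[OF \<open>\<sigma> \<in> X\<close>]]) auto
  moreover have "card {\<nu> \<in> X. w \<sigma> \<nu> \<noteq> 0 \<and> f \<sigma> < f \<nu>} \<le> Suc 0"
    using assms(1,2) by (simp add: discrete_morse_bott_def D_snc_def)
  ultimately show ?thesis
    using assms(3-) by (simp add: card_le_Suc0_iff_eq)
qed

text \<open>A coface \<open>\<tau>\<close> of \<open>\<sigma>\<close> below \<open>f \<sigma>\<close> would have two faces between itself and \<open>\<nu>\<close>; as cofaces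
  of \<open>\<nu>\<close> both have value at least \<open>f \<nu> > f \<tau>\<close>, which is one too many.\<close>

lemma U_snc_eq_0_if_face:
  assumes mb: "discrete_morse_bott X w f"
    and cells: "\<sigma> \<in> X" "\<nu> \<in> X" and face: "w \<sigma> \<nu> \<noteq> 0"
    and same_value: "f \<sigma> = f \<nu>" and crit: "U_snc X w f \<nu> = 0"
  shows "U_snc X w f \<sigma> = 0"
proof (rule ccontr)
  assume "U_snc X w f \<sigma> \<noteq> 0"
  then obtain \<tau> where \<tau>: "\<tau> \<in> X" "w \<tau> \<sigma> \<noteq> 0" "f \<tau> < f \<sigma>"
    using U_snc_eq_0_iff[OF \<open>\<sigma> \<in> X\<close>] by (auto simp: not_le)
  obtain \<sigma>' where \<sigma>': "\<sigma>' \<in> X" "\<sigma>' \<noteq> \<sigma>" "w \<tau> \<sigma>' \<noteq> 0" "w \<sigma>' \<nu> \<noteq> 0"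
    using ex_other_cell_between[OF \<tau>(1) cells \<tau>(2) face] .
  have "f \<nu> \<le> f \<sigma>'"
    using crit \<sigma>' U_snc_eq_0_iff[OF \<open>\<nu> \<in> X\<close>] by blast
  then have "f \<tau> < f \<sigma>'"
    using \<tau>(3) same_value by simp
  then show False
    using higher_face_unique[OF mb \<tau>(1) cells(1) \<tau>(2,3) \<sigma>'(1,3)] \<sigma>'(2) by simp
qed

text \<open>The dual argument: a face \<open>\<nu>\<close> of \<open>\<sigma>\<close> above \<open>f \<sigma>\<close> would have two cofaces between \<open>\<tau>\<close> and
  itself, both of value at most \<open>f \<tau> < f \<nu>\<close>.\<close>

lemma D_snc_eq_0_if_coface:
  assumes mb: "discrete_morse_bott X w f"
    and cells: "\<tau> \<in> X" "\<sigma> \<in> X" and face: "w \<tau> \<sigma> \<noteq> 0"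
    and same_value: "f \<tau> = f \<sigma>" and crit: "D_snc X w f \<tau> = 0"
  shows "D_snc X w f \<sigma> = 0"
proof (rule ccontr)
  assume "D_snc X w f \<sigma> \<noteq> 0"
  then obtain \<nu> where \<nu>: "\<nu> \<in> X" "w \<sigma> \<nu> \<noteq> 0" "f \<sigma> < f \<nu>"
    using D_snc_eq_0_iff[OF \<open>\<sigma> \<in> X\<close>] by (auto simp: not_le)
  obtain \<sigma>' where \<sigma>': "\<sigma>' \<in> X" "\<sigma>' \<noteq> \<sigma>" "w \<tau> \<sigma>' \<noteq> 0" "w \<sigma>' \<nu> \<noteq> 0"
    using ex_other_cell_between[OF cells \<nu>(1) face \<nu>(2)] .
  have "f \<sigma>' \<le> f \<tau>"
    using crit \<sigma>' D_snc_eq_0_iff[OF \<open>\<tau> \<in> X\<close>] by blast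
  then have "f \<sigma>' < f \<nu>"
    using \<nu>(3) same_value by simp
  then show False
    using lower_coface_unique[OF mb \<nu>(1) cells(2) \<nu>(2,3) \<sigma>'(1,4)] \<sigma>'(2) by simp
qed

lemma weakly_critical_set_between:
  assumes mb: "discrete_morse_bott X w f" and C: "weakly_critical_set X w f C"
    and \<tau>: "\<tau> \<in> C" and \<nu>: "\<nu> \<in> C"
    and \<sigma>: "\<sigma> \<in> X" "w \<tau> \<sigma> \<noteq> 0" "w \<sigma> \<nu> \<noteq> 0"
  shows "\<sigma> \<in> C"
proof -
  obtain r where r: "C = {\<sigma> \<in> X. f \<sigma> = r \<and> U_snc X w f \<sigma> = 0 \<and> D_snc X w f \<sigma> = 0}"
    using C by (auto simp: weakly_critical_set_def level_set_def)
  have \<tau>': "\<tau> \<in> X" "f \<tau> = r" "D_snc X w f \<tau> = 0"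
    and \<nu>': "\<nu> \<in> X" "f \<nu> = r" "U_snc X w f \<nu> = 0"
    using \<tau> \<nu> by (auto simp: r)
  have "f \<sigma> \<le> r" "r \<le> f \<sigma>"
    using D_snc_eq_0_iff[of \<tau> f] U_snc_eq_0_iff[of \<nu> f] \<tau>' \<nu>' \<sigma> by auto
  then have "f \<sigma> = r" by simp
  moreover have "U_snc X w f \<sigma> = 0"
    using U_snc_eq_0_if_face[OF mb \<sigma>(1) \<nu>'(1) \<sigma>(3) _ \<nu>'(3)] \<nu>'(2) \<open>f \<sigma> = r\<close> by simp
  moreover have "D_snc X w f \<sigma> = 0"
    using D_snc_eq_0_if_coface[OF mb \<tau>'(1) \<sigma>(1,2) _ \<tau>'(3)] \<tau>'(2) \<open>f \<sigma> = r\<close> by simp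
  ultimately show ?thesis
    using \<sigma>(1) by (simp add: r)
qed

text \<open>For \<open>\<tau>\<close> and \<open>\<nu>\<close> in such a set \<open>A\<close>, restricting the sum in (L2) to \<open>A\<close> loses no nonzero
  term.\<close>

lemma is_subcomplex_if_between_closed:
  assumes "A \<subseteq> X"
    and between: "\<And>\<tau> \<sigma> \<nu>. \<lbrakk>\<tau> \<in> A; \<nu> \<in> A; \<sigma> \<in> X; w \<tau> \<sigma> \<noteq> 0; w \<sigma> \<nu> \<noteq> 0\<rbrakk> \<Longrightarrow> \<sigma> \<in> A"
  shows "is_subcomplex X cdim w A"
  unfolding is_subcomplex_def
proof (intro conjI)
  show "lefschetz_complex A cdim w"
  proof
    show "finite {\<sigma> \<in> A. cdim \<sigma> = k}" for k
      using \<open>A \<subseteq> X\<close> by (intro finite_subset[OF _ finite_dim[of k]]) auto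
  next
    show "int (cdim \<tau>) - int (cdim \<sigma>) = 1" if "\<tau> \<in> A" "\<sigma> \<in> A" "w \<tau> \<sigma> \<noteq> 0" for \<tau> \<sigma>
      using that \<open>A \<subseteq> X\<close> by (intro L1) auto
  next
    fix \<tau> \<nu> assume "\<tau> \<in> A" "\<nu> \<in> A"
    then have "\<sigma> \<in> A \<longleftrightarrow> \<sigma> \<in> X" if "w \<tau> \<sigma> * w \<sigma> \<nu> \<noteq> 0" for \<sigma>
      using that between[of \<tau> \<nu> \<sigma>] subsetD[OF \<open>A \<subseteq> X\<close>, of \<sigma>] by auto
    then have "{\<sigma> \<in> A. w \<tau> \<sigma> * w \<sigma> \<nu> \<noteq> 0} = {\<sigma> \<in> X. w \<tau> \<sigma> * w \<sigma> \<nu> \<noteq> 0}"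
      by blast
    then show "(\<Sum>\<sigma> | \<sigma> \<in> A \<and> w \<tau> \<sigma> * w \<sigma> \<nu> \<noteq> 0. w \<tau> \<sigma> * w \<sigma> \<nu>) = 0"
      using L2[of \<tau> \<nu>] subsetD[OF \<open>A \<subseteq> X\<close>] \<open>\<tau> \<in> A\<close> \<open>\<nu> \<in> A\<close> by simp
  qed
qed (fact \<open>A \<subseteq> X\<close>)

end

theorem proposition4p4:
  fixes X :: "'a set" and cdim :: "'a \<Rightarrow> nat" and w :: "'a \<Rightarrow> 'a \<Rightarrow> real"
    and f :: "'a \<Rightarrow> real" and C :: "'a set"
  assumes "lefschetz_complex X cdim w"
    and "discrete_morse_bott X w f"
    and "weakly_critical_set X w f C"
  shows "is_subcomplex X cdim w C"
proof -
  interpret lefschetz_complex X cdim w by fact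
  show ?thesis
  proof (rule is_subcomplex_if_between_closed)
    show "C \<subseteq> X"
      using assms(3) by (auto simp: weakly_critical_set_def level_set_def)
  qed (rule weakly_critical_set_between[OF assms(2,3)])
qed

end
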